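(* Consider masses with $m_1=m_2=\nu m_3$, $\nu>0$. The points $p_a:\ (\sigma_1,\sigma_2,\sigma_3)=(\pi/3,\pi/3,\pi/2)$ and $p_b:\ (\sigma_1,\sigma_2,\sigma_3)=(2\pi/3,2\pi/3,\pi/2)$ are bifurcation points between isosceles $LRE$ and scalene $LRE$ (each for a suitable value of $\nu>0$).
   Context: Three point masses $m_1,m_2,m_3>0$ move on the unit sphere $\mathbb{S}^2$ under the cotangent potential. A shape is a triple $(\sigma_1,\sigma_2,\sigma_3)$, where $\sigma_k$ is the angle of the minor arc between masses $i$ and $j$, $\{i,j,k\}=\{1,2,3\}$. Let $U=(0,\pi)^3$ and $U_{\mathrm{phys}}=\{(\sigma_1,\sigma_2,\sigma_3)\in U:\ \sigma_k\le\sigma_i+\sigma_j \text{ for all } \{i,j,k\}=\{1,2,3\},\ \sigma_1+\sigma_2+\sigma_3\le 2\pi\}$. For $\{i,j,k\}=\{1,2,3\}$ set $$\lambda_i=\frac{(m_j+m_k)\sin^3\sigma_i-m_j\cos\sigma_k\sin^3\sigma_j-m_k\cos\sigma_j\sin^3\sigma_k}{\sin^3\sigma_i}.$$ A shape in $U_{\mathrm{phys}}$ forms a Lagrange relative equilibrium ($LRE$) iff $\lambda_1=\lambda_2=\lambda_3$ (this depends only on the $\sigma$'s and the mass ratios). A continuation of $LRE$ (for fixed masses) is a regular $C^1$ curve of such shapes. A bifurcation point between isosceles and scalene $LRE$ is a point at which a continuation consisting of isosceles shapes with $\sigma_1=\sigma_2$ intersects a continuation consisting, apart from the intersection point, of scalene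 shapes ($\sigma_1,\sigma_2,\sigma_3$ pairwise distinct), both for the same masses. *)

theory Defs
  imports "HOL-Analysis.Analysis"
begin

text \<open>Shapes and mass triples are vectors in \<open>real ^ 3\<close>, with components \<open>$ 1\<close>, \<open>$ 2\<close>, \<open>$ 3\<close>.\<close>

definition U :: "(real ^ 3) set" where
  "U = {\<sigma>. \<forall>k. 0 < \<sigma> $ k \<and> \<sigma> $ k < pi}"

definition U_phys :: "(real ^ 3) set" where
  "U_phys = {\<sigma> \<in> U. \<sigma> $ 1 \<le> \<sigma> $ 2 + \<sigma> $ 3 \<and> \<sigma> $ 2 \<le> \<sigma> $ 3 + \<sigma> $ 1 \<and> \<sigma> $ 3 \<le> \<sigma> $ 1 + \<sigma> $ 2 \<and>
     \<sigma> $ 1 + \<sigma> $ 2 + \<sigma> $ 3 \<le> 2 * pi}"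

text \<open>Only used with \<open>{i, j, k} = {1, 2, 3}\<close>; the formula is symmetric in \<open>j\<close> and \<open>k\<close>.\<close>

definition lam :: "real ^ 3 \<Rightarrow> real ^ 3 \<Rightarrow> 3 \<Rightarrow> 3 \<Rightarrow> 3 \<Rightarrow> real" where
  "lam m \<sigma> i j k =
     ((m $ j + m $ k) * sin (\<sigma> $ i) ^ 3
       - m $ j * cos (\<sigma> $ k) * sin (\<sigma> $ j) ^ 3
       - m $ k * cos (\<sigma> $ j) * sin (\<sigma> $ k) ^ 3) / sin (\<sigma> $ i) ^ 3"

text \<open>Lagrange relative equilibria are identified with their shapes, by the shape criterion.\<close>

definition LRE :: "real ^ 3 \<Rightarrow> (real ^ 3) set" where
  "LRE m = {\<sigma> \<in> U_phys. lam m \<sigma> 1 2 3 = lam m \<sigma> 2 3 1 \<and> lam m \<sigma> 2 3 1 = lam m \<sigma> 3 1 2}"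

definition scalene :: "real ^ 3 \<Rightarrow> bool" where
  "scalene \<sigma> \<longleftrightarrow> \<sigma> $ 1 \<noteq> \<sigma> $ 2 \<and> \<sigma> $ 2 \<noteq> \<sigma> $ 3 \<and> \<sigma> $ 3 \<noteq> \<sigma> $ 1"

definition regular_C1_curve :: "real set \<Rightarrow> (real \<Rightarrow> real ^ 3) \<Rightarrow> bool" where
  "regular_C1_curve I \<gamma> \<longleftrightarrow> open I \<and> is_interval I \<and> I \<noteq> {} \<and>
     \<gamma> C1_differentiable_on I \<and> (\<forall>t\<in>I. vector_derivative \<gamma> (at t) \<noteq> 0)"

definition continuation :: "real ^ 3 \<Rightarrow> real set \<Rightarrow> (real \<Rightarrow> real ^ 3) \<Rightarrow> bool" where
  "continuation m I \<gamma> \<longleftrightarrow> regular_C1_curve I \<gamma> \<and> \<gamma> ` I \<subseteq> LRE m"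

text \<open>The parameter intervals are open, so both curves pass through \<open>p\<close> rather than end there.\<close>

definition bifurcation_point :: "real ^ 3 \<Rightarrow> real ^ 3 \<Rightarrow> bool" where
  "bifurcation_point m p \<longleftrightarrow>
     (\<exists>I \<gamma> t\<^sub>0 J \<delta> u\<^sub>0.
        continuation m I \<gamma> \<and> t\<^sub>0 \<in> I \<and> \<gamma> t\<^sub>0 = p \<and> (\<forall>t\<in>I. \<gamma> t $ 1 = \<gamma> t $ 2) \<and>
        continuation m J \<delta> \<and> u\<^sub>0 \<in> J \<and> \<delta> u\<^sub>0 = p \<and> (\<forall>u\<in>J - {u\<^sub>0}. scalene (\<delta> u)))"

end

theory Submission
  imports Defs
begin

text \<open>
  For masses \<open>(\<nu>m, \<nu>m, m)\<close> the difference \<open>\<lambda>\<^sub>1 - \<lambda>\<^sub>2\<close> is odd under exchanging the two equal masses. It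
  therefore vanishes on all isosceles shapes, and it factors as \<open>sin (\<sigma>\<^sub>1 - \<sigma>\<^sub>2)\<close> times a smooth
  function \<open>H\<close> (\<open>lam_quotient_12\<close>), up to a nonzero factor. Let \<open>K\<close> (\<open>lam_gap_13\<close>) be \<open>\<lambda>\<^sub>1 - \<lambda>\<^sub>3\<close> with
  its denominators cleared. Isosceles equilibria are then the zeros of \<open>(\<sigma>\<^sub>1 - \<sigma>\<^sub>2, K)\<close>, the other ones
  the zeros of \<open>(H, K)\<close>, and it suffices to find a common zero of \<open>\<sigma>\<^sub>1 - \<sigma>\<^sub>2\<close>, \<open>H\<close> and \<open>K\<close> at which
  both systems have rank two and \<open>\<sigma>\<^sub>1 - \<sigma>\<^sub>2\<close> is a local parameter for the second.

  At a shape \<open>(a, a, \<pi>/2)\<close> the term of \<open>H\<close> with the factor \<open>cos \<sigma>\<^sub>3\<close> vanishes, so that \<open>H\<close> reduces to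
  \<open>cos 2a - cos 4a\<close>, twice the derivative of \<open>cos a sin\<^sup>3 a\<close>. It is zero iff \<open>cos\<^sup>2 a = 1/4\<close>, for
  every mass ratio; this singles out \<open>a = \<pi>/3\<close> and \<open>a = 2\<pi>/3\<close>. The equation \<open>K = 0\<close> is linear in \<open>\<nu>\<close> and
  has a positive solution. Both curves come from the inverse function theorem
  (\<open>curve_of_equations\<close>): with \<open>s = sin a\<close> and \<open>c = cos a\<close>, the Jacobian of \<open>(\<sigma>\<^sub>1, \<sigma>\<^sub>1 - \<sigma>\<^sub>2, K)\<close> at the
  point is \<open>- \<nu> s\<^sup>3\<close> and that of \<open>(\<sigma>\<^sub>1 - \<sigma>\<^sub>2, H, K)\<close> is \<open>6 \<nu> c s\<^sup>4\<close>, both nonzero. Along the second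
  curve \<open>\<sigma>\<^sub>1 - \<sigma>\<^sub>2\<close> is the parameter itself, hence nonzero away from the point, and \<open>\<sigma>\<^sub>3\<close> stays different
  from both because \<open>a \<noteq> \<pi>/2\<close>.
\<close>

section \<open>Curves cut out by two equations in space\<close>

unbundle cross3_syntax

lemma vector_3_as_axes: "(vector [a, b, c] :: real ^ 3) = a *\<^sub>R axis 1 1 + b *\<^sub>R axis 2 1 + c *\<^sub>R axis 3 1"
  by (simp add: vec_eq_iff forall_3 axis_def vector_def)

lemma continuous_on_vector_3 [continuous_intros]:
  fixes a b c :: "'a::topological_space \<Rightarrow> real"
  assumes "continuous_on S a" "continuous_on S b" "continuous_on S c"
  shows "continuous_on S (\<lambda>x. vector [a x, b x, c x] :: real ^ 3)"
  unfolding vector_3_as_axes by (intro continuous_intros assms)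

lemma has_derivative_vector_3:
  fixes a b c :: "'a::real_normed_vector \<Rightarrow> real"
  assumes "(a has_derivative a') F" "(b has_derivative b') F" "(c has_derivative c') F"
  shows "((\<lambda>x. vector [a x, b x, c x] :: real ^ 3) has_derivative (\<lambda>v. vector [a' v, b' v, c' v])) F"
  unfolding vector_3_as_axes by (intro derivative_intros assms)

text \<open>Cramer's rule in vector form. It makes the inverse of a \<open>3 \<times> 3\<close> matrix visibly continuous in
  its rows, which is how the curve below is seen to be \<open>C\<^sup>1\<close>.\<close>

lemma cross3_solves:
  fixes a b c w :: "real ^ 3"
  assumes "a \<bullet> (b \<times> c) \<noteq> 0"
  shows "a \<bullet> w = x \<and> b \<bullet> w = y \<and> c \<bullet> w = z \<longleftrightarrow>
    w = (1 / (a \<bullet> (b \<times> c))) *\<^sub>R (x *\<^sub>R (b \<times> c) + y *\<^sub>R (c \<times> a) + z *\<^sub>R (a \<times> b))" (is "?L \<longleftrightarrow> w = ?w")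
proof
  assume ?L
  then have x: "x = a \<bullet> w" and y: "y = b \<bullet> w" and z: "z = c \<bullet> w" by auto
  have "(a \<bullet> (b \<times> c)) *\<^sub>R w = x *\<^sub>R (b \<times> c) + y *\<^sub>R (c \<times> a) + z *\<^sub>R (a \<times> b)"
    unfolding x y z by (simp add: vec_eq_iff forall_3 inner_vec_def sum_3 cross3_def algebra_simps)
  then have "(1 / (a \<bullet> (b \<times> c))) *\<^sub>R ((a \<bullet> (b \<times> c)) *\<^sub>R w) = ?w" by metis
  then show "w = ?w" using assms by simp
next
  define T where "T = a \<bullet> (b \<times> c)"
  have T: "b \<bullet> (c \<times> a) = T" "c \<bullet> (a \<times> b) = T"
    by (simp_all add: T_def inner_vec_def sum_3 cross3_def algebra_simps)
  assume "w = ?w"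
  then show ?L using assms T
    by (simp add: inner_add_right dot_cross_self T_def[symmetric])
qed

text \<open>The map \<open>(f, g, h)\<close> is a local diffeomorphism at \<open>p\<close>, and the curve is the preimage of a line
  parallel to the first axis. Its velocity solves \<open>f' \<bullet> v = 1\<close>, \<open>g' \<bullet> v = h' \<bullet> v = 0\<close>, so it is the multiple
  \<open>\<gamma>'\<close> of \<open>g' \<times> h'\<close> given by Cramer's rule: continuous and nonzero.\<close>

lemma curve_of_equations:
  fixes f g h :: "real ^ 3 \<Rightarrow> real" and f' g' h' :: "real ^ 3 \<Rightarrow> real ^ 3"
  assumes "open W" "p \<in> W"
    and f: "\<And>\<sigma>. \<sigma> \<in> W \<Longrightarrow> GDERIV f \<sigma> :> f' \<sigma>" "continuous_on W f'"
    and g: "\<And>\<sigma>. \<sigma> \<in> W \<Longrightarrow> GDERIV g \<sigma> :> g' \<sigma>" "continuous_on W g'"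
    and h: "\<And>\<sigma>. \<sigma> \<in> W \<Longrightarrow> GDERIV h \<sigma> :> h' \<sigma>" "continuous_on W h'"
    and indep: "f' p \<bullet> (g' p \<times> h' p) \<noteq> 0"
  obtains I \<gamma> where "regular_C1_curve I \<gamma>" "0 \<in> I" "\<gamma> 0 = p" "\<gamma> ` I \<subseteq> W"
    "\<And>t. t \<in> I \<Longrightarrow> f (\<gamma> t) = f p + t \<and> g (\<gamma> t) = g p \<and> h (\<gamma> t) = h p"
proof -
  define F where "F \<sigma> = (vector [f \<sigma>, g \<sigma>, h \<sigma>] :: real ^ 3)" for \<sigma>
  define D where "D \<sigma> v = (vector [f' \<sigma> \<bullet> v, g' \<sigma> \<bullet> v, h' \<sigma> \<bullet> v] :: real ^ 3)" for \<sigma> v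
  define T where "T \<sigma> = f' \<sigma> \<bullet> (g' \<sigma> \<times> h' \<sigma>)" for \<sigma>
  have linD: "bounded_linear (D \<sigma>)" for \<sigma>
    unfolding linear_conv_bounded_linear[symmetric]
    by (rule linearI)
      (simp_all add: D_def vec_eq_iff forall_3 inner_add_right)
  have derF: "(F has_derivative blinfun_apply (Blinfun (D \<sigma>))) (at \<sigma>)" if "\<sigma> \<in> W" for \<sigma>
    using has_derivative_vector_3[OF f(1)[OF that, unfolded gderiv_def]
        g(1)[OF that, unfolded gderiv_def] h(1)[OF that, unfolded gderiv_def]]
    unfolding bounded_linear_Blinfun_apply[OF linD]
    by (simp add: F_def[abs_def] D_def[abs_def] inner_commute)
  have contD: "continuous_on W (\<lambda>\<sigma>. Blinfun (D \<sigma>))"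
    by (rule continuous_on_blinfun_componentwise)
      (auto simp: bounded_linear_Blinfun_apply[OF linD] D_def intro!: continuous_intros f g h)
  have contT: "continuous_on W (\<lambda>\<sigma>. T \<sigma>)"
    unfolding T_def by (intro continuous_intros f g h continuous_on_cross)
  have D_eq: "D \<sigma> v = w \<longleftrightarrow>
      v = (1 / T \<sigma>) *\<^sub>R (w $ 1 *\<^sub>R (g' \<sigma> \<times> h' \<sigma>) + w $ 2 *\<^sub>R (h' \<sigma> \<times> f' \<sigma>) + w $ 3 *\<^sub>R (f' \<sigma> \<times> g' \<sigma>))"
    if "T \<sigma> \<noteq> 0" for \<sigma> v w
    using cross3_solves[OF that[unfolded T_def], of v "w $ 1" "w $ 2" "w $ 3"]
    by (auto simp: D_def vec_eq_iff forall_3 T_def)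
  define E :: "real ^ 3 \<Rightarrow> real ^ 3" where "E w = (1 / T p) *\<^sub>R (w $ 1 *\<^sub>R (g' p \<times> h' p) + w $ 2 *\<^sub>R (h' p \<times> f' p) + w $ 3 *\<^sub>R (f' p \<times> g' p))" for w
  have linE: "bounded_linear E"
    unfolding linear_conv_bounded_linear[symmetric]
    by (rule linearI) (simp_all add: E_def algebra_simps)
  have ED: "E (D p v) = v" for v
    using D_eq[of p v "D p v"] indep by (simp add: E_def T_def)
  have inv: "Blinfun E o\<^sub>L Blinfun (D p) = id_blinfun"
    by (rule blinfun_eqI) (simp add: bounded_linear_Blinfun_apply linD linE ED)
  obtain V' V G G' where V': "open V'" "V' \<subseteq> W" "p \<in> V'" and V: "open V" "F p \<in> V"
    and hom: "homeomorphism V' V F G"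
    and derG: "\<And>y. y \<in> V \<Longrightarrow> (G has_derivative G' y) (at y)"
    and G': "\<And>y. y \<in> V \<Longrightarrow> G' y = inv (blinfun_apply (Blinfun (D (G y))))"
    and bij: "\<And>y. y \<in> V \<Longrightarrow> bij (blinfun_apply (Blinfun (D (G y))))"
    by (rule inverse_function_theorem[OF \<open>open W\<close> derF contD \<open>p \<in> W\<close> inv]) blast+
  have GV: "G y \<in> V'" "F (G y) = y" if "y \<in> V" for y
    using hom that by (auto simp: homeomorphism_def)
  have GF: "G (F p) = p"
    using hom V' by (auto simp: homeomorphism_def)
  define \<gamma> where "\<gamma> t = G (F p + t *\<^sub>R axis 1 1)" for t
  define \<gamma>' where "\<gamma>' t = (1 / T (\<gamma> t)) *\<^sub>R (g' (\<gamma> t) \<times> h' (\<gamma> t))" for t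
  \<comment> \<open>The Jacobian is kept away from zero by shrinking the neighbourhood; this gives Cramer's
      formula at every point of the curve.\<close>
  define S where "S = {\<sigma> \<in> V'. T \<sigma> \<noteq> 0}"
  have "open S"
  proof -
    have "S = V' \<inter> T -` (- {0})" by (auto simp: S_def)
    then show ?thesis
      using continuous_open_preimage[of V' T "- {0}"] V' contT continuous_on_subset by auto
  qed
  have contG: "continuous_on V G" using hom by (auto simp: homeomorphism_def)
  have "open (V \<inter> G -` S)"
    by (rule continuous_open_preimage[OF contG \<open>open V\<close> \<open>open S\<close>])
  then have open_pre: "open ((\<lambda>t. F p + t *\<^sub>R axis 1 1) -` (V \<inter> G -` S))"
    by (intro open_vimage continuous_intros)
  have "0 \<in> (\<lambda>t. F p + t *\<^sub>R axis 1 1) -` (V \<inter> G -` S)"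
    using V V' indep by (simp add: GF S_def T_def)
  then obtain \<epsilon> where "\<epsilon> > 0" and \<epsilon>: "ball 0 \<epsilon> \<subseteq> (\<lambda>t. F p + t *\<^sub>R axis 1 1) -` (V \<inter> G -` S)"
    using open_pre open_contains_ball by blast
  define I where "I = ball (0 :: real) \<epsilon>"
  have \<gamma>I: "F p + t *\<^sub>R axis 1 1 \<in> V" "\<gamma> t \<in> V'" "T (\<gamma> t) \<noteq> 0" if "t \<in> I" for t
    using \<epsilon> that by (auto simp: I_def S_def \<gamma>_def)
  have der: "(\<gamma> has_vector_derivative \<gamma>' t) (at t)" if t: "t \<in> I" for t
  proof -
    let ?y = "F p + t *\<^sub>R axis 1 1"
    have "((\<lambda>t. F p + t *\<^sub>R axis 1 1) has_derivative (\<lambda>s. s *\<^sub>R axis 1 1)) (at t)"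
      by (auto intro!: derivative_eq_intros)
    from has_derivative_compose[OF this derG[OF \<gamma>I(1)[OF t]]]
    have 1: "(\<gamma> has_derivative (\<lambda>s. G' ?y (s *\<^sub>R axis 1 1))) (at t)"
      by (simp add: \<gamma>_def[abs_def])
    have "G' ?y (s *\<^sub>R axis 1 1) = s *\<^sub>R \<gamma>' t" for s
    proof -
      have "D (\<gamma> t) (s *\<^sub>R \<gamma>' t) = s *\<^sub>R axis 1 1"
        by (subst D_eq) (use \<gamma>I(3)[OF t] in \<open>simp_all add: \<gamma>'_def axis_def\<close>)
      then show ?thesis
        using G'[OF \<gamma>I(1)[OF t]] bij[OF \<gamma>I(1)[OF t]]
        by (simp add: \<gamma>_def bounded_linear_Blinfun_apply[OF linD]) (metis bij_inv_eq_iff)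
    qed
    then show ?thesis using 1 by (simp add: has_vector_derivative_def)
  qed
  have \<gamma>W: "\<gamma> ` I \<subseteq> W" using \<gamma>I(2) V'(2) by auto
  have cont\<gamma>: "continuous_on I \<gamma>"
    using der continuous_at_imp_continuous_on has_vector_derivative_continuous by blast
  have comp: "continuous_on I (\<lambda>t. k (\<gamma> t))" if "continuous_on W k" for k :: "real ^ 3 \<Rightarrow> real ^ 3"
    by (rule continuous_on_compose2[OF that cont\<gamma> \<gamma>W])
  have "continuous_on I \<gamma>'"
    unfolding \<gamma>'_def T_def
    by (intro continuous_intros comp continuous_on_cross f g h) (use \<gamma>I(3) in \<open>auto simp: T_def\<close>)
  then have C1: "\<gamma> C1_differentiable_on I"
    using der by (auto simp: C1_differentiable_on_def)
  have "\<gamma>' t \<noteq> 0" if "t \<in> I" for t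
  proof
    assume 0: "\<gamma>' t = 0"
    have "g' (\<gamma> t) \<times> h' (\<gamma> t) = 0" using 0 \<gamma>I(3)[OF that] by (simp add: \<gamma>'_def)
    with \<gamma>I(3)[OF that] show False by (simp add: T_def)
  qed
  then have "vector_derivative \<gamma> (at t) \<noteq> 0" if "t \<in> I" for t
    using that vector_derivative_at[OF der[OF that]] by simp
  then have "regular_C1_curve I \<gamma>"
    using C1 \<open>\<epsilon> > 0\<close> by (auto simp: regular_C1_curve_def I_def is_interval_ball_real)
  moreover have "f (\<gamma> t) = f p + t \<and> g (\<gamma> t) = g p \<and> h (\<gamma> t) = h p" if "t \<in> I" for t
  proof -
    have "F (\<gamma> t) = F p + t *\<^sub>R axis 1 1"
      using GV(2)[OF \<gamma>I(1)[OF that]] by (simp add: \<gamma>_def)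
    then show ?thesis by (simp add: F_def vec_eq_iff forall_3 axis_def)
  qed
  moreover have "0 \<in> I" "\<gamma> 0 = p"
    using \<open>\<epsilon> > 0\<close> by (simp_all add: I_def \<gamma>_def GF)
  ultimately show thesis
    using that \<gamma>W by blast
qed


section \<open>The equilibrium equations\<close>

definition lam_gap_13 :: "real \<Rightarrow> real ^ 3 \<Rightarrow> real" where
  "lam_gap_13 \<nu> \<sigma> =
     (1 - \<nu>) * sin (\<sigma> $ 1) ^ 3 * sin (\<sigma> $ 3) ^ 3 - \<nu> * cos (\<sigma> $ 3) * sin (\<sigma> $ 2) ^ 3 * sin (\<sigma> $ 3) ^ 3
     - cos (\<sigma> $ 2) * sin (\<sigma> $ 3) ^ 6
     + \<nu> * (cos (\<sigma> $ 2) * sin (\<sigma> $ 1) ^ 6 + cos (\<sigma> $ 1) * sin (\<sigma> $ 1) ^ 3 * sin (\<sigma> $ 2) ^ 3)"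

text \<open>The quotient of \<open>\<lambda>\<^sub>1 - \<lambda>\<^sub>2\<close> by \<open>sin (\<sigma>\<^sub>1 - \<sigma>\<^sub>2)\<close>, up to powers of sines. Writing it in the angles
  \<open>\<sigma>\<^sub>1 + \<sigma>\<^sub>2\<close> and \<open>\<sigma>\<^sub>1 - \<sigma>\<^sub>2\<close> carries out the division, so that the function is smooth at isosceles
  shapes.\<close>

definition lam_quotient_12 :: "real \<Rightarrow> real ^ 3 \<Rightarrow> real" where
  "lam_quotient_12 \<nu> \<sigma> =
     2 * \<nu> * cos (\<sigma> $ 3) * sin (\<sigma> $ 1 + \<sigma> $ 2)
       * (sin (\<sigma> $ 1) ^ 4 + sin (\<sigma> $ 1) ^ 2 * sin (\<sigma> $ 2) ^ 2 + sin (\<sigma> $ 2) ^ 4)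
     + sin (\<sigma> $ 3) ^ 3 *
       (cos (\<sigma> $ 1 + \<sigma> $ 2) - cos (2 * (\<sigma> $ 1 + \<sigma> $ 2)) * cos (\<sigma> $ 1 - \<sigma> $ 2))"

lemma lam_diff_13:
  assumes "sin (\<sigma> $ 1) \<noteq> 0" "sin (\<sigma> $ 3) \<noteq> 0"
  shows "lam (vector [\<nu> * m, \<nu> * m, m]) \<sigma> 1 2 3 - lam (vector [\<nu> * m, \<nu> * m, m]) \<sigma> 3 1 2
    = m * lam_gap_13 \<nu> \<sigma> / (sin (\<sigma> $ 1) ^ 3 * sin (\<sigma> $ 3) ^ 3)"
  using assms by (simp add: lam_def lam_gap_13_def divide_simps) algebra

text \<open>The two identities behind the factorization are \<open>sin\<^sup>2 x - sin\<^sup>2 y = sin (x + y) sin (x - y)\<close>, and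
  \<open>8 cos x sin\<^sup>3 x = 2 sin 2x - sin 4x\<close> followed by sum-to-product.\<close>

lemma lam_diff_12:
  assumes "sin (\<sigma> $ 1) \<noteq> 0" "sin (\<sigma> $ 2) \<noteq> 0"
  shows "lam (vector [\<nu> * m, \<nu> * m, m]) \<sigma> 1 2 3 - lam (vector [\<nu> * m, \<nu> * m, m]) \<sigma> 2 3 1
    = m * sin (\<sigma> $ 1 - \<sigma> $ 2) * lam_quotient_12 \<nu> \<sigma> / (2 * sin (\<sigma> $ 1) ^ 3 * sin (\<sigma> $ 2) ^ 3)"
proof -
  define a b c a' b' c' where ab: "a = sin (\<sigma> $ 1)" "b = sin (\<sigma> $ 2)" "c = sin (\<sigma> $ 3)"
    "a' = cos (\<sigma> $ 1)" "b' = cos (\<sigma> $ 2)" "c' = cos (\<sigma> $ 3)"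
  have sq: "a'\<^sup>2 = 1 - a\<^sup>2" "b'\<^sup>2 = 1 - b\<^sup>2"
    by (simp_all add: ab cos_squared_eq)
  have 1: "2 * (a ^ 6 - b ^ 6) = (a * b' - a' * b) * (2 * (a * b' + a' * b) * (a ^ 4 + a\<^sup>2 * b\<^sup>2 + b ^ 4))"
    using sq by algebra
  have 2: "2 * (a' * a ^ 3 - b' * b ^ 3) =
      (a * b' - a' * b) * ((a' * b' - a * b) - (2 * (a' * b' - a * b)\<^sup>2 - 1) * (a' * b' + a * b))"
    using sq by algebra
  have "2 * (\<nu> * c' * (a ^ 6 - b ^ 6) + c ^ 3 * (a' * a ^ 3 - b' * b ^ 3)) = sin (\<sigma> $ 1 - \<sigma> $ 2) * lam_quotient_12 \<nu> \<sigma>"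
    unfolding lam_quotient_12_def cos_double_cos[of "\<sigma> $ 1 + \<sigma> $ 2"] sin_add cos_add sin_diff cos_diff ab[symmetric]
    using 1 2 by algebra
  then show ?thesis
    using assms by (simp add: lam_def ab[symmetric] divide_simps mult.assoc) algebra
qed

lemma LRE_of_zeros:
  assumes "\<sigma> \<in> U_phys" "lam_gap_13 \<nu> \<sigma> = 0" "\<sigma> $ 1 = \<sigma> $ 2 \<or> lam_quotient_12 \<nu> \<sigma> = 0"
  shows "\<sigma> \<in> LRE (vector [\<nu> * m, \<nu> * m, m])"
proof -
  have "sin (\<sigma> $ k) \<noteq> 0" for k
    using assms(1) sin_gt_zero[of "\<sigma> $ k"] by (auto simp: U_phys_def U_def)
  then show ?thesis
    using assms lam_diff_13[of \<sigma> \<nu> m] lam_diff_12[of \<sigma> \<nu> m] by (auto simp: LRE_def)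
qed

section \<open>Gradients\<close>

definition lam_gap_13_grad :: "real \<Rightarrow> real ^ 3 \<Rightarrow> real ^ 3" where
  "lam_gap_13_grad \<nu> \<sigma> = (let a = sin (\<sigma> $ 1); b = sin (\<sigma> $ 2); c = sin (\<sigma> $ 3);
      a' = cos (\<sigma> $ 1); b' = cos (\<sigma> $ 2); c' = cos (\<sigma> $ 3) in
    vector [
      3 * (1 - \<nu>) * a ^ 2 * a' * c ^ 3 + \<nu> * (6 * b' * a ^ 5 * a' + 3 * a' ^ 2 * a ^ 2 * b ^ 3 - a ^ 4 * b ^ 3),
      - 3 * \<nu> * c' * b ^ 2 * b' * c ^ 3 + b * c ^ 6 + \<nu> * (3 * a' * a ^ 3 * b ^ 2 * b' - b * a ^ 6),
      3 * (1 - \<nu>) * a ^ 3 * c ^ 2 * c' + \<nu> * c ^ 4 * b ^ 3 - 3 * \<nu> * c' ^ 2 * b ^ 3 * c ^ 2 - 6 * b' * c ^ 5 * c'])"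

definition lam_quotient_12_grad :: "real \<Rightarrow> real ^ 3 \<Rightarrow> real ^ 3" where
  "lam_quotient_12_grad \<nu> \<sigma> = (let a = sin (\<sigma> $ 1); b = sin (\<sigma> $ 2); c = sin (\<sigma> $ 3);
      a' = cos (\<sigma> $ 1); b' = cos (\<sigma> $ 2); c' = cos (\<sigma> $ 3); s = \<sigma> $ 1 + \<sigma> $ 2; d = \<sigma> $ 1 - \<sigma> $ 2;
      q = a ^ 4 + a ^ 2 * b ^ 2 + b ^ 4 in
    vector [
      2 * \<nu> * c' * (cos s * q + sin s * (4 * a ^ 3 * a' + 2 * a * a' * b ^ 2))
        + c ^ 3 * (2 * sin (2 * s) * cos d + cos (2 * s) * sin d - sin s),
      2 * \<nu> * c' * (cos s * q + sin s * (4 * b ^ 3 * b' + 2 * b * b' * a ^ 2))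
        + c ^ 3 * (2 * sin (2 * s) * cos d - cos (2 * s) * sin d - sin s),
      3 * c ^ 2 * c' * (cos s - cos (2 * s) * cos d) - 2 * \<nu> * c * sin s * q])"

lemmas has_derivative_vec_nth = bounded_linear.has_derivative[OF bounded_linear_vec_nth]

lemma GDERIV_lam_gap_13: "GDERIV (lam_gap_13 \<nu>) \<sigma> :> lam_gap_13_grad \<nu> \<sigma>"
  unfolding gderiv_def lam_gap_13_def[abs_def]
  apply (rule derivative_eq_intros has_derivative_vec_nth refl)+
  apply (rule ext)
  apply (simp add: lam_gap_13_grad_def Let_def inner_vec_def sum_3)
  apply algebra
  done

lemma GDERIV_lam_quotient_12: "GDERIV (lam_quotient_12 \<nu>) \<sigma> :> lam_quotient_12_grad \<nu> \<sigma>"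
  unfolding gderiv_def lam_quotient_12_def[abs_def]
  apply (rule derivative_eq_intros has_derivative_vec_nth refl)+
  apply (rule ext)
  apply (simp add: lam_quotient_12_grad_def Let_def inner_vec_def sum_3)
  apply algebra
  done

lemma continuous_on_lam_gap_13_grad: "continuous_on S (lam_gap_13_grad \<nu>)"
  unfolding lam_gap_13_grad_def[abs_def] Let_def by (intro continuous_intros)

lemma continuous_on_lam_quotient_12_grad: "continuous_on S (lam_quotient_12_grad \<nu>)"
  unfolding lam_quotient_12_grad_def[abs_def] Let_def by (intro continuous_intros)

lemma GDERIV_component_1: "GDERIV (\<lambda>\<sigma> :: real ^ 3. \<sigma> $ 1) \<sigma> :> vector [1, 0, 0]"
  unfolding gderiv_def
  by (rule derivative_eq_intros has_derivative_vec_nth refl ext | simp add: inner_vec_def sum_3)+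

lemma GDERIV_component_diff: "GDERIV (\<lambda>\<sigma> :: real ^ 3. \<sigma> $ 1 - \<sigma> $ 2) \<sigma> :> vector [1, - 1, 0]"
  unfolding gderiv_def
  by (rule derivative_eq_intros has_derivative_vec_nth refl ext | simp add: inner_vec_def sum_3)+

section \<open>The two bifurcation points\<close>

text \<open>An open part of \<open>U_phys\<close>. Curves that stay in it are physical, and scalene as soon as
  \<open>\<sigma>\<^sub>1 \<noteq> \<sigma>\<^sub>2\<close>.\<close>

definition distinct_base_shapes :: "(real ^ 3) set" where
  "distinct_base_shapes = {\<sigma>. (\<forall>k. 0 < \<sigma> $ k \<and> \<sigma> $ k < pi) \<and>
     \<sigma> $ 1 < \<sigma> $ 2 + \<sigma> $ 3 \<and> \<sigma> $ 2 < \<sigma> $ 3 + \<sigma> $ 1 \<and> \<sigma> $ 3 < \<sigma> $ 1 + \<sigma> $ 2 \<and>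
     \<sigma> $ 1 + \<sigma> $ 2 + \<sigma> $ 3 < 2 * pi \<and> \<sigma> $ 3 \<noteq> \<sigma> $ 1 \<and> \<sigma> $ 3 \<noteq> \<sigma> $ 2}"

lemma open_distinct_base_shapes: "open distinct_base_shapes"
  unfolding distinct_base_shapes_def forall_3
  by (intro open_Collect_conj open_Collect_less open_Collect_neq continuous_intros)

lemma distinct_base_shapes_subset: "distinct_base_shapes \<subseteq> U_phys"
  by (auto simp: distinct_base_shapes_def U_phys_def U_def)

text \<open>The bounds on \<open>a\<close> are the strict triangle inequality \<open>\<pi>/2 < 2a\<close> and the strict perimeter
  bound \<open>2a + \<pi>/2 < 2\<pi>\<close>. Both bifurcation points are covered at once, since only the sign of \<open>cos a\<close>
  distinguishes them.\<close>

lemma bifurcation_point_right_base: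
  fixes a m :: real
  assumes a: "pi / 4 < a" "a < 3 * pi / 4" and cos_a: "(cos a)\<^sup>2 = 1 / 4"
  shows "\<exists>\<nu>>0. bifurcation_point (vector [\<nu> * m, \<nu> * m, m]) (vector [a, a, pi / 2])"
proof -
  define s c where "s = sin a" and "c = cos a"
  have c2: "c\<^sup>2 = 1 / 4" using cos_a by (simp add: c_def)
  have s2: "s\<^sup>2 = 3 / 4" using cos_a by (simp add: s_def sin_squared_eq)
  have "s > 0" using a by (simp add: s_def sin_gt_zero)
  have "s < 1" "s > 3 / 4"
    using s2 \<open>s > 0\<close> power2_less_imp_less[of s 1] power2_less_imp_less[of "3 / 4" s]
    by (simp_all add: power2_eq_square)
  have s3: "s ^ 3 = 3 / 4 * s" using s2 by algebra
  have c_cases: "c = 1 / 2 \<or> c = - 1 / 2" using c2 by algebra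
  \<comment> \<open>The solution of \<open>K = 0\<close> at \<open>(a, a, \<pi>/2)\<close>, which reads \<open>(1 - \<nu>) s\<^sup>3 - c + 2 \<nu> c s\<^sup>6 = 0\<close>.\<close>
  define \<nu> where "\<nu> = (s ^ 3 - c) / (s ^ 3 * (1 - 2 * c * s ^ 3))"
  have num: "s ^ 3 - c > 0" "1 - 2 * c * s ^ 3 > 0"
    using c_cases
  proof (atomize (full), elim disjE)
    assume c: "c = 1 / 2"
    show "s ^ 3 - c > 0 \<and> 1 - 2 * c * s ^ 3 > 0"
      unfolding s3 c using \<open>s > 3 / 4\<close> \<open>s < 1\<close> by simp
  next
    assume c: "c = - 1 / 2"
    show "s ^ 3 - c > 0 \<and> 1 - 2 * c * s ^ 3 > 0"
      unfolding s3 c using \<open>s > 3 / 4\<close> by simp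
  qed
  have "\<nu> > 0" using num \<open>s > 0\<close> by (simp add: \<nu>_def)
  have \<nu>: "\<nu> * (s ^ 3 * (1 - 2 * c * s ^ 3)) = s ^ 3 - c"
    using num \<open>s > 0\<close> by (simp add: \<nu>_def)
  define p where "p = (vector [a, a, pi / 2] :: real ^ 3)"
  have p[simp]: "p $ 1 = a" "p $ 2 = a" "p $ 3 = pi / 2" by (simp_all add: p_def)
  have "a \<noteq> pi / 2"
  proof
    assume "a = pi / 2"
    then have "cos a = 0" by (simp only: cos_pi_half)
    with cos_a show False by simp
  qed
  then have "p \<in> distinct_base_shapes" using a by (auto simp: distinct_base_shapes_def forall_3)
  have K0: "lam_gap_13 \<nu> p = 0"
    using \<nu> by (simp add: lam_gap_13_def s_def[symmetric] c_def[symmetric]) algebra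
  have dbl: "sin (2 * a) = 2 * s * c" "cos (2 * a) = - 1 / 2"
    using c2 by (simp_all add: sin_double cos_double_cos s_def c_def)
  have quad: "sin (4 * a) = - 2 * s * c" "cos (4 * a) = - 1 / 2"
    using sin_double[of "2 * a"] cos_double_cos[of "2 * a"] dbl by (simp_all add: power2_eq_square)
  have H0: "lam_quotient_12 \<nu> p = 0"
    by (simp add: lam_quotient_12_def dbl quad)
  \<comment> \<open>At an isosceles shape only the derivative along \<open>(1, 1, 0)\<close> enters the Jacobian, that is, the sum
      of the first two partial derivatives.\<close>
  have "lam_gap_13_grad \<nu> p $ 1 + lam_gap_13_grad \<nu> p $ 2
      = 3 * (1 - \<nu>) * s\<^sup>2 * c + s + \<nu> * (12 * c\<^sup>2 * s ^ 5 - 2 * s ^ 7)"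
    by (simp add: lam_gap_13_grad_def Let_def s_def[symmetric] c_def[symmetric]) algebra
  also have "\<dots> = 2 * s"
    using \<nu> c2 s2 by algebra
  finally have K': "lam_gap_13_grad \<nu> p $ 1 + lam_gap_13_grad \<nu> p $ 2 = 2 * s" "lam_gap_13_grad \<nu> p $ 3 = \<nu> * s ^ 3"
    by (simp_all add: lam_gap_13_grad_def Let_def s_def[symmetric] c_def[symmetric])
  have H': "lam_quotient_12_grad \<nu> p $ 1 + lam_quotient_12_grad \<nu> p $ 2 = - 12 * s * c" "lam_quotient_12_grad \<nu> p $ 3 = - 12 * \<nu> * c * s ^ 5"
    by (simp_all add: lam_quotient_12_grad_def Let_def dbl quad s_def[symmetric] c_def[symmetric]) algebra+
  have LRE: "\<sigma> \<in> LRE (vector [\<nu> * m, \<nu> * m, m])"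
    if "\<sigma> \<in> distinct_base_shapes" "lam_gap_13 \<nu> \<sigma> = 0" "\<sigma> $ 1 = \<sigma> $ 2 \<or> lam_quotient_12 \<nu> \<sigma> = 0" for \<sigma>
    using LRE_of_zeros that distinct_base_shapes_subset by blast

  \<comment> \<open>Isosceles branch: the leg angle is a parameter because \<open>K\<close> has nonzero derivative in the base.\<close>
  have indep1: "vector [1, 0, 0] \<bullet> (vector [1, - 1, 0] \<times> lam_gap_13_grad \<nu> p) \<noteq> 0"
    using K' \<open>\<nu> > 0\<close> \<open>s > 0\<close> by (simp add: inner_vec_def sum_3 cross3_def)
  obtain I \<gamma> where \<gamma>: "regular_C1_curve I \<gamma>" "0 \<in> I" "\<gamma> 0 = p" "\<gamma> ` I \<subseteq> distinct_base_shapes"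
    "\<And>t. t \<in> I \<Longrightarrow> \<gamma> t $ 1 = p $ 1 + t \<and> \<gamma> t $ 1 - \<gamma> t $ 2 = p $ 1 - p $ 2 \<and> lam_gap_13 \<nu> (\<gamma> t) = lam_gap_13 \<nu> p"
    by (rule curve_of_equations[OF open_distinct_base_shapes \<open>p \<in> distinct_base_shapes\<close>
        GDERIV_component_1 continuous_on_const GDERIV_component_diff continuous_on_const
        GDERIV_lam_gap_13 continuous_on_lam_gap_13_grad indep1]) blast
  \<comment> \<open>Scalene branch: the parameter is the difference of the two leg angles.\<close>
  have "vector [1, - 1, 0] \<bullet> (lam_quotient_12_grad \<nu> p \<times> lam_gap_13_grad \<nu> p)
      = (lam_quotient_12_grad \<nu> p $ 1 + lam_quotient_12_grad \<nu> p $ 2) * lam_gap_13_grad \<nu> p $ 3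
        - lam_quotient_12_grad \<nu> p $ 3 * (lam_gap_13_grad \<nu> p $ 1 + lam_gap_13_grad \<nu> p $ 2)"
    by (simp add: inner_vec_def sum_3 cross3_def algebra_simps)
  also have "\<dots> = 6 * \<nu> * c * s ^ 4"
    unfolding K' H' using s2 by algebra
  finally have indep2: "vector [1, - 1, 0] \<bullet> (lam_quotient_12_grad \<nu> p \<times> lam_gap_13_grad \<nu> p) \<noteq> 0"
    using \<open>\<nu> > 0\<close> \<open>s > 0\<close> c2 by auto
  obtain J \<delta> where \<delta>: "regular_C1_curve J \<delta>" "0 \<in> J" "\<delta> 0 = p" "\<delta> ` J \<subseteq> distinct_base_shapes"
    "\<And>t. t \<in> J \<Longrightarrow> \<delta> t $ 1 - \<delta> t $ 2 = p $ 1 - p $ 2 + t \<and> lam_quotient_12 \<nu> (\<delta> t) = lam_quotient_12 \<nu> p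
      \<and> lam_gap_13 \<nu> (\<delta> t) = lam_gap_13 \<nu> p"
    by (rule curve_of_equations[OF open_distinct_base_shapes \<open>p \<in> distinct_base_shapes\<close>
        GDERIV_component_diff continuous_on_const GDERIV_lam_quotient_12 continuous_on_lam_quotient_12_grad
        GDERIV_lam_gap_13 continuous_on_lam_gap_13_grad indep2]) blast
  have "\<gamma> ` I \<subseteq> LRE (vector [\<nu> * m, \<nu> * m, m])"
    using \<gamma>(4,5) K0 by (auto intro!: LRE)
  moreover have "\<delta> ` J \<subseteq> LRE (vector [\<nu> * m, \<nu> * m, m])"
    using \<delta>(4,5) K0 H0 by (auto intro!: LRE)
  moreover have "scalene (\<delta> t)" if "t \<in> J - {0}" for t
    using \<delta>(5)[of t] \<delta>(4) that by (auto simp: scalene_def distinct_base_shapes_def)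
  moreover have "\<gamma> t $ 1 = \<gamma> t $ 2" if "t \<in> I" for t
    using \<gamma>(5)[OF that] by simp
  ultimately have "bifurcation_point (vector [\<nu> * m, \<nu> * m, m]) p"
    using \<gamma>(1-3) \<delta>(1-3) unfolding bifurcation_point_def continuation_def by blast
  then show ?thesis using \<open>\<nu> > 0\<close> by (auto simp: p_def)
qed

theorem mainTheorem3:
  fixes m\<^sub>3 :: real
  assumes "m\<^sub>3 > 0"
  shows "(\<exists>\<nu>>0. bifurcation_point (vector [\<nu> * m\<^sub>3, \<nu> * m\<^sub>3, m\<^sub>3]) (vector [pi / 3, pi / 3, pi / 2])) \<and>
    (\<exists>\<nu>>0. bifurcation_point (vector [\<nu> * m\<^sub>3, \<nu> * m\<^sub>3, m\<^sub>3]) (vector [2 * pi / 3, 2 * pi / 3, pi / 2]))"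
proof
  show "\<exists>\<nu>>0. bifurcation_point (vector [\<nu> * m\<^sub>3, \<nu> * m\<^sub>3, m\<^sub>3]) (vector [pi / 3, pi / 3, pi / 2])"
    by (rule bifurcation_point_right_base) (simp_all add: cos_60 power2_eq_square)
  show "\<exists>\<nu>>0. bifurcation_point (vector [\<nu> * m\<^sub>3, \<nu> * m\<^sub>3, m\<^sub>3]) (vector [2 * pi / 3, 2 * pi / 3, pi / 2])"
    by (rule bifurcation_point_right_base) (simp_all add: cos_120 power2_eq_square)
qed

end
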